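(* Let $n\ge 1$, let $\beta>0$ be fixed, and let $\alpha_k,\alpha^*_k>0$ for $k=1,\ldots,n$. Let $X_1,\ldots,X_n$ be independent random variables with $X_k\sim \mathcal{LFR}(\alpha_k,\beta)$, and let $Y_1,\ldots,Y_n$ be independent random variables with $Y_k\sim \mathcal{LFR}(\alpha^*_k,\beta)$, $k=1,\ldots,n$. If $\alpha_k\ge\alpha^*_k$ for every $k=1,\ldots,n$, then $X_{1:n}\le_{disp}Y_{1:n}$.
   Context: For $\alpha,\beta>0$, a random variable $X$ has the linear failure rate distribution, written $X\sim\mathcal{LFR}(\alpha,\beta)$, if its cumulative distribution function is $F_X(x)=1-\exp\{-(\alpha x+\frac{\beta}{2}x^2)\}$ for $x>0$ (and $0$ for $x\le 0$). $X_{1:n}=\min\{X_1,\ldots,X_n\}$ and $Y_{1:n}=\min\{Y_1,\ldots,Y_n\}$ denote the smallest order statistics (lifetimes of series systems). For nonnegative absolutely continuous random variables $X,Y$ with cumulative distribution functions $F_X,G_Y$ and quantile functions $F_X^{-1},G_Y^{-1}$, the dispersive order $X\le_{disp}Y$ means $F_X^{-1}(q)-F_X^{-1}(p)\le G_Y^{-1}(q)-G_Y^{-1}(p)$ whenever $0<p\le q<1$; equivalently, $G_Y^{-1}(p)-F_X^{-1}(p)$ is increasing (i.e. non-decreasing) in $p\in(0,1)$. *)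

theory Defs
  imports "HOL-Probability.Probability"
begin

definition LFR_cdf :: "real \<Rightarrow> real \<Rightarrow> real \<Rightarrow> real" where
  "LFR_cdf \<alpha> \<beta> x = (if x > 0 then 1 - exp (- (\<alpha> * x + \<beta> / 2 * x\<^sup>2)) else 0)"

definition LFR_distributed :: "'a measure \<Rightarrow> ('a \<Rightarrow> real) \<Rightarrow> real \<Rightarrow> real \<Rightarrow> bool" where
  "LFR_distributed M X \<alpha> \<beta> \<longleftrightarrow>
     X \<in> borel_measurable M \<and> (\<forall>x. cdf (distr M borel X) x = LFR_cdf \<alpha> \<beta> x)"

text \<open>Left-continuous inverse of the distribution function. It is used only for 0 < p < 1,
  where the set is nonempty and bounded below, so that the infimum is the genuine one.\<close>

definition quantile_fun :: "'a measure \<Rightarrow> ('a \<Rightarrow> real) \<Rightarrow> real \<Rightarrow> real" where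
  "quantile_fun M X p = Inf {x. p \<le> cdf (distr M borel X) x}"

text \<open>The order compares distributions only, so the two random variables may live on different
  probability spaces. The condition makes sense for all real random variables; nonnegativity and
  absolute continuity are not part of it.\<close>

definition dispersive_le ::
  "'a measure \<Rightarrow> ('a \<Rightarrow> real) \<Rightarrow> 'b measure \<Rightarrow> ('b \<Rightarrow> real) \<Rightarrow> bool" where
  "dispersive_le M X N Y \<longleftrightarrow>
     (\<forall>p q. 0 < p \<and> p \<le> q \<and> q < 1 \<longrightarrow>
        quantile_fun M X q - quantile_fun M X p \<le> quantile_fun N Y q - quantile_fun N Y p)"

definition smallest_order_stat :: "nat \<Rightarrow> (nat \<Rightarrow> 'a \<Rightarrow> real) \<Rightarrow> 'a \<Rightarrow> real" where
  "smallest_order_stat n X \<omega> = Min ((\<lambda>k. X k \<omega>) ` {1..n})"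

end

theory Submission
  imports Defs
begin

text \<open>
  The minimum of independent \<open>LFR(\<alpha>\<^sub>k, \<beta>)\<close> variables is \<open>LFR(A, n \<beta>)\<close> with \<open>A = \<Sum>\<^sub>k \<alpha>\<^sub>k\<close>, so
  both minima share the second parameter \<open>B = n \<beta>\<close>. With \<open>t = - ln (1 - p)\<close> the quantile is
  \<open>(sqrt (A\<^sup>2 + 2 B t) - A) / B\<close>, and the increment
  \<open>sqrt (A\<^sup>2 + 2 B t') - sqrt (A\<^sup>2 + 2 B t)\<close> is \<open>2 B (t' - t)\<close> divided by the sum of the two
  roots, hence decreasing in \<open>A\<close>.
\<close>

lemma (in prob_space) smallest_order_stat_measurable:
  assumes "n \<ge> 1" and "\<And>k. k \<in> {1..n} \<Longrightarrow> X k \<in> borel_measurable M"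
  shows "smallest_order_stat n X \<in> borel_measurable M"
proof -
  have "(\<lambda>\<omega>. Min ((\<lambda>k. X k \<omega>) ` {1..n})) \<in> borel_measurable M"
    using assms by (intro borel_measurable_Min) auto
  then show ?thesis
    by (simp add: smallest_order_stat_def[abs_def])
qed

lemma (in prob_space) prob_greaterThan_eq_cdf:
  assumes "X \<in> borel_measurable M"
  shows "prob (X -` {x<..} \<inter> space M) = 1 - cdf (distr M borel X) x"
proof -
  have "X -` {x<..} \<inter> space M = space M - (X -` {..x} \<inter> space M)"
    by auto
  moreover have "X -` {..x} \<inter> space M \<in> events"
    using assms by (rule measurable_sets) simp
  ultimately show ?thesis
    using assms by (simp add: prob_compl cdf_def measure_distr)
qed

text \<open>The minimum exceeds \<open>x\<close> exactly when every \<open>X k\<close> does, and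
  independence turns the probability of this intersection into a product. Hence the passage to
  survival functions \<open>1 - cdf\<close>.\<close>

lemma (in prob_space) cdf_smallest_order_stat:
  assumes "n \<ge> 1" and "indep_vars (\<lambda>_. borel) X {1..n}"
  shows "cdf (distr M borel (smallest_order_stat n X)) x
           = 1 - (\<Prod>k=1..n. 1 - cdf (distr M borel (X k)) x)"
proof -
  have meas: "X k \<in> borel_measurable M" if "k \<in> {1..n}" for k
    using assms(2) that by (simp add: indep_vars_def)
  have "smallest_order_stat n X -` {x<..} \<inter> space M
          = (\<Inter>k\<in>{1..n}. X k -` {x<..} \<inter> space M)"
    using assms(1) by (auto simp: smallest_order_stat_def)
  then have "prob (smallest_order_stat n X -` {x<..} \<inter> space M)
               = (\<Prod>k=1..n. prob (X k -` {x<..} \<inter> space M))"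
    using assms indep_varsD[OF assms(2), of "{1..n}" "\<lambda>_. {x<..}"] by simp
  also have "\<dots> = (\<Prod>k=1..n. 1 - cdf (distr M borel (X k)) x)"
    using meas by (intro prod.cong refl prob_greaterThan_eq_cdf)
  finally show ?thesis
    using prob_greaterThan_eq_cdf[OF smallest_order_stat_measurable[OF assms(1) meas], where x = x]
    by simp
qed

text \<open>For \<open>x > 0\<close> each survival function is the exponential of a quadratic in
  \<open>x\<close> without constant term. Multiplying them adds the exponents, so both parameters
  add up. For \<open>x \<le> 0\<close> every factor is 1.\<close>

lemma (in prob_space) LFR_distributed_smallest_order_stat:
  assumes "n \<ge> 1" and "indep_vars (\<lambda>_. borel) X {1..n}"
    and "\<And>k. k \<in> {1..n} \<Longrightarrow> LFR_distributed M (X k) (\<alpha> k) (\<beta> k)"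
  shows "LFR_distributed M (smallest_order_stat n X) (\<Sum>k=1..n. \<alpha> k) (\<Sum>k=1..n. \<beta> k)"
proof -
  have "cdf (distr M borel (smallest_order_stat n X)) x
          = LFR_cdf (\<Sum>k=1..n. \<alpha> k) (\<Sum>k=1..n. \<beta> k) x" for x
  proof -
    have "cdf (distr M borel (smallest_order_stat n X)) x
            = 1 - (\<Prod>k=1..n. 1 - LFR_cdf (\<alpha> k) (\<beta> k) x)"
      using assms by (simp add: cdf_smallest_order_stat LFR_distributed_def)
    also have "\<dots> = LFR_cdf (\<Sum>k=1..n. \<alpha> k) (\<Sum>k=1..n. \<beta> k) x"
    proof (cases "x > 0")
      case True
      have "(\<Prod>k=1..n. 1 - LFR_cdf (\<alpha> k) (\<beta> k) x)
              = exp (\<Sum>k=1..n. - (\<alpha> k * x + \<beta> k / 2 * x\<^sup>2))"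
        using True by (simp add: LFR_cdf_def exp_sum)
      also have "(\<Sum>k=1..n. - (\<alpha> k * x + \<beta> k / 2 * x\<^sup>2))
              = - ((\<Sum>k=1..n. \<alpha> k) * x + (\<Sum>k=1..n. \<beta> k) / 2 * x\<^sup>2)"
        by (simp add: sum.distrib sum_negf sum_distrib_right sum_divide_distrib sum_subtractf)
      finally show ?thesis
        using True by (simp add: LFR_cdf_def)
    qed (simp add: LFR_cdf_def)
    finally show ?thesis .
  qed
  moreover have "smallest_order_stat n X \<in> borel_measurable M"
    using assms by (intro smallest_order_stat_measurable) (auto simp: LFR_distributed_def)
  ultimately show ?thesis
    by (simp add: LFR_distributed_def)
qed

text \<open>The threshold is the positive root of
  \<open>A * x + B / 2 * x\<^sup>2 = - ln (1 - p)\<close>. In the form of an equivalence, the set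
  whose infimum is the quantile becomes a closed half-line.\<close>

lemma le_LFR_cdf_iff:
  assumes "A > 0" "B > 0" "0 < p" "p < 1"
  shows "p \<le> LFR_cdf A B x \<longleftrightarrow> (sqrt (A\<^sup>2 + 2 * B * - ln (1 - p)) - A) / B \<le> x"
proof (cases "x > 0")
  case True
  have "p \<le> LFR_cdf A B x \<longleftrightarrow> exp (- (A * x + B / 2 * x\<^sup>2)) \<le> 1 - p"
    using True by (auto simp: LFR_cdf_def)
  also have "\<dots> \<longleftrightarrow> - ln (1 - p) \<le> A * x + B / 2 * x\<^sup>2"
    using assms ln_ge_iff[of "1 - p" "- (A * x + B / 2 * x\<^sup>2)"] by auto
  also have "\<dots> \<longleftrightarrow> 2 * B * - ln (1 - p) \<le> 2 * B * (A * x + B / 2 * x\<^sup>2)"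
    using assms by (subst mult_le_cancel_left_pos) auto
  \<comment> \<open>The factor \<open>2 * B\<close> was introduced to complete the square
    here.\<close>
  also have "2 * B * (A * x + B / 2 * x\<^sup>2) = (A + B * x)\<^sup>2 - A\<^sup>2"
    by (simp add: power2_eq_square algebra_simps)
  also have "2 * B * - ln (1 - p) \<le> (A + B * x)\<^sup>2 - A\<^sup>2
               \<longleftrightarrow> A\<^sup>2 + 2 * B * - ln (1 - p) \<le> (A + B * x)\<^sup>2"
    by auto
  \<comment> \<open>Since \<open>x > 0\<close>, \<open>A + B * x\<close> is positive and hence
    equals the root of its square.\<close>
  also have "\<dots> \<longleftrightarrow> sqrt (A\<^sup>2 + 2 * B * - ln (1 - p)) \<le> A + B * x"
    using assms True real_sqrt_le_iff[of _ "(A + B * x)\<^sup>2"] by simp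
  also have "\<dots> \<longleftrightarrow> (sqrt (A\<^sup>2 + 2 * B * - ln (1 - p)) - A) / B \<le> x"
    using assms by (simp add: pos_divide_le_eq algebra_simps)
  finally show ?thesis .
next
  case False
  \<comment> \<open>For \<open>x \<le> 0\<close> the distribution function is 0, which is below
    \<open>p\<close>; it remains to see that the threshold is positive.\<close>
  have "ln (1 - p) < 0"
    using assms by simp
  then have "B * ln (1 - p) < 0"
    using assms by (simp add: mult_pos_neg)
  then have "A < sqrt (A\<^sup>2 + 2 * B * - ln (1 - p))"
    by (intro real_less_rsqrt) simp
  then have "0 < (sqrt (A\<^sup>2 + 2 * B * - ln (1 - p)) - A) / B"
    using assms by simp
  with False have "\<not> (sqrt (A\<^sup>2 + 2 * B * - ln (1 - p)) - A) / B \<le> x"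
    by linarith
  with False assms show ?thesis
    by (simp add: LFR_cdf_def)
qed

lemma quantile_fun_LFR:
  assumes "LFR_distributed M X A B" "A > 0" "B > 0" "0 < p" "p < 1"
  shows "quantile_fun M X p = (sqrt (A\<^sup>2 + 2 * B * - ln (1 - p)) - A) / B"
proof -
  have "{x. p \<le> cdf (distr M borel X) x} = {(sqrt (A\<^sup>2 + 2 * B * - ln (1 - p)) - A) / B..}"
    using assms le_LFR_cdf_iff[of A B p] by (auto simp: LFR_distributed_def)
  then show ?thesis
    by (simp add: quantile_fun_def)
qed

text \<open>This is concavity of the square root. Each difference times the sum of the same two
  roots is \<open>t - s\<close>, and the sum is larger for \<open>b\<close> than for
  \<open>a\<close>.\<close>

lemma sqrt_add_diff_antimono:
  assumes "0 \<le> a" "a \<le> b" "0 \<le> s" "s \<le> t"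
  shows "sqrt (b + t) - sqrt (b + s) \<le> sqrt (a + t) - sqrt (a + s)"
proof (cases "a + t = 0")
  case False
  have diff: "(sqrt (c + t) - sqrt (c + s)) * (sqrt (c + t) + sqrt (c + s)) = t - s"
    if "0 \<le> c" for c
    using that assms by (simp add: algebra_simps)
  have pos: "0 < sqrt (a + t) + sqrt (a + s)"
    using False assms by (intro add_pos_nonneg) auto
  \<comment> \<open>Both differences are compared after multiplication by the sum of roots for
    \<open>a\<close>, which is positive and can be cancelled at the end.\<close>
  have "(sqrt (b + t) - sqrt (b + s)) * (sqrt (a + t) + sqrt (a + s))
          \<le> (sqrt (b + t) - sqrt (b + s)) * (sqrt (b + t) + sqrt (b + s))"
    using assms by (intro mult_left_mono add_mono) auto
  also have "\<dots> = (sqrt (a + t) - sqrt (a + s)) * (sqrt (a + t) + sqrt (a + s))"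
    using assms by (simp only: diff order.trans[OF assms(1,2)])
  finally show ?thesis
    using pos by simp
next
  case True
  \<comment> \<open>Here that sum vanishes and cannot be cancelled, but \<open>s = t\<close> makes
    both differences 0.\<close>
  then have "a = 0" "s = 0" "t = 0"
    using assms by linarith+
  then show ?thesis
    by simp
qed

lemma dispersive_le_LFR:
  assumes "LFR_distributed M X A B" "LFR_distributed N Y A' B"
    and "0 < A'" "A' \<le> A" "0 < B"
  shows "dispersive_le M X N Y"
  unfolding dispersive_le_def
proof (intro allI impI)
  fix p q :: real
  assume pq: "0 < p \<and> p \<le> q \<and> q < 1"
  define s t where "s = 2 * B * - ln (1 - p)" and "t = 2 * B * - ln (1 - q)"
  have "0 \<le> s" "s \<le> t"
    using pq assms by (auto simp: s_def t_def mult_nonneg_nonpos)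
  moreover have "A'\<^sup>2 \<le> A\<^sup>2"
    using assms by (intro power_mono) auto
  ultimately have "sqrt (A\<^sup>2 + t) - sqrt (A\<^sup>2 + s) \<le> sqrt (A'\<^sup>2 + t) - sqrt (A'\<^sup>2 + s)"
    by (intro sqrt_add_diff_antimono) auto
  \<comment> \<open>The offsets \<open>A\<close> and \<open>A'\<close> cancel within each increment,
    and the common \<open>B\<close> leaves the same positive divisor on both sides.\<close>
  then have "(sqrt (A\<^sup>2 + t) - A) / B - (sqrt (A\<^sup>2 + s) - A) / B
               \<le> (sqrt (A'\<^sup>2 + t) - A') / B - (sqrt (A'\<^sup>2 + s) - A') / B"
    using assms by (simp add: divide_right_mono flip: diff_divide_distrib)
  then show "quantile_fun M X q - quantile_fun M X p \<le> quantile_fun N Y q - quantile_fun N Y p"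
    using pq assms
    by (simp add: quantile_fun_LFR[OF assms(1)] quantile_fun_LFR[OF assms(2)] s_def t_def)
qed

theorem theorem4p1:
  fixes M :: "'a measure" and N :: "'b measure"
    and X :: "nat \<Rightarrow> 'a \<Rightarrow> real" and Y :: "nat \<Rightarrow> 'b \<Rightarrow> real"
    and n :: nat and \<alpha> \<alpha>' :: "nat \<Rightarrow> real" and \<beta> :: real
  assumes "prob_space M" and "prob_space N"
    and "n \<ge> 1" and "\<beta> > 0"
    and "\<And>k. k \<in> {1..n} \<Longrightarrow> \<alpha> k > 0"
    and "\<And>k. k \<in> {1..n} \<Longrightarrow> \<alpha>' k > 0"
    and "prob_space.indep_vars M (\<lambda>_. borel) X {1..n}"
    and "prob_space.indep_vars N (\<lambda>_. borel) Y {1..n}"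
    and "\<And>k. k \<in> {1..n} \<Longrightarrow> LFR_distributed M (X k) (\<alpha> k) \<beta>"
    and "\<And>k. k \<in> {1..n} \<Longrightarrow> LFR_distributed N (Y k) (\<alpha>' k) \<beta>"
    and "\<And>k. k \<in> {1..n} \<Longrightarrow> \<alpha> k \<ge> \<alpha>' k"
  shows "dispersive_le M (smallest_order_stat n X) N (smallest_order_stat n Y)"
proof (rule dispersive_le_LFR)
  \<comment> \<open>The sum of the constant \<open>\<beta>\<close> does not involve
    \<open>\<alpha>\<close> or \<open>\<alpha>'\<close>, so it serves as the common second parameter
    of both minima.\<close>
  show "LFR_distributed M (smallest_order_stat n X) (\<Sum>k=1..n. \<alpha> k) (\<Sum>k=1..n. \<beta>)"
    using assms by (intro prob_space.LFR_distributed_smallest_order_stat) auto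
  show "LFR_distributed N (smallest_order_stat n Y) (\<Sum>k=1..n. \<alpha>' k) (\<Sum>k=1..n. \<beta>)"
    using assms by (intro prob_space.LFR_distributed_smallest_order_stat) auto
  show "0 < (\<Sum>k=1..n. \<alpha>' k)" "0 < (\<Sum>k=1..n. \<beta>)"
    using assms by (auto intro!: sum_pos)
  show "(\<Sum>k=1..n. \<alpha>' k) \<le> (\<Sum>k=1..n. \<alpha> k)"
    using assms by (intro sum_mono) auto
qed

end
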